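(* Let $G$ be a connected graph of order $n>1$. Then $d_d(a)\le WI(G)$ for every vertex $a\in V(G)$.
   Context: Graphs are finite, simple and undirected. A dominating set of a graph $G$ is a set $D\subseteq V(G)$ such that every vertex in $V(G)\setminus D$ is adjacent to some vertex of $D$. A minimal dominating set is a dominating set that does not properly contain any other dominating set. The domination degree of a vertex $a$ is $d_d(a)=\min\{|D| : D \text{ is a minimal dominating set of } G \text{ with } a\in D\}$. $WI(G)$ denotes the Wiener index of $G$, i.e. the sum of the distances $d(u,v)$ over all unordered pairs $\{u,v\}$ of distinct vertices of $G$. The order of a graph is its number of vertices. *)

theory Defs
  imports "Graph_Theory.Graph_Theory"
begin

text \<open>
  Finite simple undirected graphs are the symmetric digraphs of the locale \<^locale>\<open>graph\<close>
  (finite, loop-free, no parallel arcs): an edge \<open>{u, v}\<close> is the pair of opposite arcs between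
  \<open>u\<close> and \<open>v\<close>, so adjacency is \<open>u \<rightarrow>\<^bsub>G\<^esub> v\<close>.
\<close>

definition dominating_set :: "('a, 'b) pre_digraph \<Rightarrow> 'a set \<Rightarrow> bool" where
  "dominating_set G D \<longleftrightarrow>
     D \<subseteq> verts G \<and> (\<forall>v \<in> verts G - D. \<exists>u \<in> D. v \<rightarrow>\<^bsub>G\<^esub> u)"

definition minimal_dominating_set :: "('a, 'b) pre_digraph \<Rightarrow> 'a set \<Rightarrow> bool" where
  "minimal_dominating_set G D \<longleftrightarrow>
     dominating_set G D \<and> \<not> (\<exists>D'. dominating_set G D' \<and> D' \<subset> D)"

definition domination_degree :: "('a, 'b) pre_digraph \<Rightarrow> 'a \<Rightarrow> nat" where
  "domination_degree G a = Min {card D | D. minimal_dominating_set G D \<and> a \<in> D}"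

text \<open>Length of a shortest walk; meaningful only if \<open>v\<close> is reachable from \<open>u\<close>.\<close>

definition graph_dist :: "('a, 'b) pre_digraph \<Rightarrow> 'a \<Rightarrow> 'a \<Rightarrow> nat" where
  "graph_dist G u v = (LEAST k. \<exists>p. pre_digraph.awalk G u p v \<and> length p = k)"

text \<open>
  The distance between the two elements of an unordered pair; well defined because the distance
  in a graph is symmetric, see \<open>pair_dist_doubleton\<close> below.
\<close>

definition pair_dist :: "('a, 'b) pre_digraph \<Rightarrow> 'a set \<Rightarrow> nat" where
  "pair_dist G e = (THE k. \<exists>u v. e = {u, v} \<and> k = graph_dist G u v)"

definition wiener_index :: "('a, 'b) pre_digraph \<Rightarrow> nat" where
  "wiener_index G = (\<Sum>e \<in> {{u, v} | u v. u \<in> verts G \<and> v \<in> verts G \<and> u \<noteq> v}. pair_dist G e)"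

lemma (in sym_digraph) awalk_reverse:
  assumes "awalk u p v"
  shows "\<exists>q. awalk v q u \<and> length q = length p"
  using assms
proof (induction p arbitrary: u)
  case Nil
  then show ?case by (auto simp: awalk_Nil_iff)
next
  case (Cons e p)
  then have e: "e \<in> arcs G" "u = tail G e" and "awalk (head G e) p v"
    by (auto simp: awalk_Cons_iff)
  then obtain q where q: "awalk v q (head G e)" "length q = length p"
    using Cons.IH by blast
  from e have "u \<rightarrow>\<^bsub>G\<^esub> head G e"
    by (auto intro: in_arcs_imp_in_arcs_ends)
  then have "head G e \<rightarrow>\<^bsub>G\<^esub> u"
    using sym_arcs unfolding symmetric_def by (rule symD[rotated])
  then obtain e' where "e' \<in> arcs G" "tail G e' = head G e" "head G e' = u"
    by auto
  with q have "awalk v (q @ [e']) u" by (auto simp: awalk_simps)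
  with q show ?case by (intro exI[of _ "q @ [e']"]) simp
qed

lemma (in sym_digraph) graph_dist_commute: "graph_dist G u v = graph_dist G v u"
proof -
  have "(\<exists>p. awalk u p v \<and> length p = k) = (\<exists>p. awalk v p u \<and> length p = k)" for k
    using awalk_reverse by metis
  then show ?thesis by (simp add: graph_dist_def)
qed

lemma (in sym_digraph) pair_dist_doubleton: "pair_dist G {u, v} = graph_dist G u v"
  unfolding pair_dist_def
  by (rule the_equality) (auto simp: doubleton_eq_iff graph_dist_commute)

end

theory Submission
  imports Defs
begin

text \<open>
  Extend \<open>{a}\<close> to a maximal independent set \<open>D\<close>.  Maximality makes \<open>D\<close> dominating and independence
  makes it minimal as such, so \<open>|D|\<close> bounds the domination degree of \<open>a\<close> from above.  A neighbour
  \<open>w\<close> of \<open>a\<close>, which exists because the graph is connected and has a second vertex, cannot lie in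
  \<open>D\<close>.  Hence the pairs \<open>{w, v}\<close> with \<open>v \<in> D\<close> form a star of \<open>|D|\<close> genuine pairs centred at \<open>w\<close>,
  and each contributes at least 1 to the Wiener index.
\<close>

definition independent_set :: "('a, 'b) pre_digraph \<Rightarrow> 'a set \<Rightarrow> bool" where
  "independent_set G I \<longleftrightarrow> I \<subseteq> verts G \<and> (\<forall>u \<in> I. \<forall>v \<in> I. \<not> u \<rightarrow>\<^bsub>G\<^esub> v)"

text \<open>
  A vertex removed from an independent set has no neighbour left in the set, so no proper subset
  dominates.
\<close>

lemma independent_dominating_imp_minimal:
  assumes "independent_set G D" and "dominating_set G D"
  shows "minimal_dominating_set G D"
proof -
  have False if D': "dominating_set G D'" "D' \<subset> D" for D'
  proof -
    from \<open>D' \<subset> D\<close> obtain v where v: "v \<in> D" "v \<notin> D'" by blast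
    moreover from v(1) assms(1) have "v \<in> verts G" by (auto simp: independent_set_def)
    ultimately obtain u where "u \<in> D'" "v \<rightarrow>\<^bsub>G\<^esub> u"
      using D'(1) unfolding dominating_set_def by (meson DiffI)
    moreover from this(1) D'(2) have "u \<in> D" by blast
    ultimately show False using v(1) assms(1) unfolding independent_set_def by metis
  qed
  with assms(2) show ?thesis unfolding minimal_dominating_set_def by metis
qed

text \<open>
  A vertex that \<open>D\<close> leaves undominated could be added to \<open>D\<close>: symmetry of adjacency excludes arcs
  in both directions, and there are no loops.
\<close>

lemma (in graph) maximal_independent_imp_dominating:
  assumes indep: "independent_set G D"
    and maximal: "\<And>I. independent_set G I \<Longrightarrow> D \<subseteq> I \<Longrightarrow> I = D"
  shows "dominating_set G D"
  unfolding dominating_set_def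
proof (intro conjI ballI)
  show "D \<subseteq> verts G" using indep by (simp add: independent_set_def)
next
  fix v assume v: "v \<in> verts G - D"
  show "\<exists>u \<in> D. v \<rightarrow>\<^bsub>G\<^esub> u"
  proof (rule ccontr)
    assume "\<not> (\<exists>u \<in> D. v \<rightarrow>\<^bsub>G\<^esub> u)"
    moreover have "v \<rightarrow>\<^bsub>G\<^esub> u" if "u \<rightarrow>\<^bsub>G\<^esub> v" for u
      using that sym_arcs unfolding symmetric_def by (blast dest: symD)
    moreover have "\<not> v \<rightarrow>\<^bsub>G\<^esub> v" using adj_not_same by blast
    ultimately have "independent_set G (insert v D)"
      using indep v unfolding independent_set_def by blast
    with maximal have "insert v D = D" by blast
    with v show False by blast
  qed
qed

lemma (in graph) ex_independent_minimal_dominating_set: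
  assumes "a \<in> verts G"
  obtains D where "a \<in> D" "independent_set G D" "minimal_dominating_set G D"
proof -
  have "finite {I. independent_set G I}"
    by (rule finite_subset[of _ "Pow (verts G)"]) (auto simp: independent_set_def)
  moreover have "{a} \<in> {I. independent_set G I}"
    using assms adj_not_same by (auto simp: independent_set_def)
  ultimately obtain D where D: "independent_set G D" "{a} \<subseteq> D"
    and "\<And>I. independent_set G I \<Longrightarrow> D \<subseteq> I \<Longrightarrow> I = D"
    using finite_has_maximal2[of "{I. independent_set G I}" "{a}"] by blast
  then have "dominating_set G D" by (intro maximal_independent_imp_dominating)
  with D that show thesis by (blast intro: independent_dominating_imp_minimal)
qed

text \<open>Finiteness is what makes the minimum defining the domination degree meaningful.\<close>

lemma (in graph) domination_degree_le:
  assumes "minimal_dominating_set G D" and "a \<in> D"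
  shows "domination_degree G a \<le> card D"
proof -
  have "{D. minimal_dominating_set G D \<and> a \<in> D} \<subseteq> Pow (verts G)"
    by (auto simp: minimal_dominating_set_def dominating_set_def)
  then have "finite {D. minimal_dominating_set G D \<and> a \<in> D}"
    by (rule finite_subset) simp
  then have "finite {card D | D. minimal_dominating_set G D \<and> a \<in> D}"
    by simp
  then show ?thesis
    unfolding domination_degree_def using assms by (auto intro: Min_le)
qed

lemma (in graph) connected_imp_ex_neighbour:
  assumes "connected G" and "card (verts G) > 1" and "a \<in> verts G"
  obtains w where "a \<rightarrow>\<^bsub>G\<^esub> w"
proof -
  have "\<not> verts G \<subseteq> {a}"
    using assms(2) card_mono[of "{a}" "verts G"] by auto
  then obtain b where "b \<in> verts G" "b \<noteq> a" by blast
  then have "a \<rightarrow>\<^sup>*\<^bsub>G\<^esub> b"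
    using symmetric_connected_imp_strongly_connected[OF sym_arcs assms(1)] assms(3) by blast
  with \<open>b \<noteq> a\<close> that show thesis by (blast elim: converse_reachable_cases)
qed

text \<open>
  Connectedness matters here: it guarantees that some walk exists, so that the least length is
  attained, and a walk of length 0 joins a vertex only to itself.
\<close>

lemma (in graph) graph_dist_pos:
  assumes "connected G" and "u \<in> verts G" "v \<in> verts G" "u \<noteq> v"
  shows "graph_dist G u v > 0"
proof -
  have "u \<rightarrow>\<^sup>*\<^bsub>G\<^esub> v"
    using symmetric_connected_imp_strongly_connected[OF sym_arcs assms(1)] assms(2,3) by blast
  then have "\<exists>k p. awalk u p v \<and> length p = k" by (auto simp: reachable_awalk)
  then have "\<exists>p. awalk u p v \<and> length p = graph_dist G u v"
    unfolding graph_dist_def by (rule LeastI_ex)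
  then show ?thesis
    using \<open>u \<noteq> v\<close> by (cases "graph_dist G u v") (auto simp: awalk_Nil_iff)
qed

text \<open>The pairs \<open>{w, v}\<close> with \<open>v \<in> S\<close> are distinct, and each has distance at least 1.\<close>

lemma (in graph) card_le_wiener_index:
  assumes "connected G" and "S \<subseteq> verts G" and "w \<in> verts G - S"
  shows "card S \<le> wiener_index G"
proof -
  let ?P = "{{u, v} | u v. u \<in> verts G \<and> v \<in> verts G \<and> u \<noteq> v}"
  let ?star = "(\<lambda>v. {w, v}) ` S"
  have "finite ?P"
    by (rule finite_subset[of _ "Pow (verts G)"]) auto
  have "card S = card ?star"
    by (rule card_image[symmetric]) (auto simp: inj_on_def doubleton_eq_iff)
  also have "\<dots> = (\<Sum>e \<in> ?star. 1)" by simp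
  also have "\<dots> \<le> (\<Sum>e \<in> ?star. pair_dist G e)"
    using assms by (intro sum_mono) (auto simp: pair_dist_doubleton Suc_le_eq intro!: graph_dist_pos)
  also have "\<dots> \<le> wiener_index G"
    unfolding wiener_index_def
    using \<open>finite ?P\<close> assms(2,3) by (intro sum_mono2) blast+
  finally show ?thesis .
qed

theorem theorem3p5:
  fixes G :: "('a, 'b) pre_digraph" and a :: 'a
  assumes "graph G"
    and "connected G"
    and "card (verts G) > 1"
    and "a \<in> verts G"
  shows "domination_degree G a \<le> wiener_index G"
proof -
  interpret graph G by fact
  obtain D where D: "a \<in> D" "independent_set G D" "minimal_dominating_set G D"
    using assms(4) by (rule ex_independent_minimal_dominating_set)
  obtain w where w: "a \<rightarrow>\<^bsub>G\<^esub> w"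
    using assms(2-4) by (rule connected_imp_ex_neighbour)
  then have "w \<in> verts G - D"
    using D adj_in_verts(2)[OF w] by (auto simp: independent_set_def)
  moreover have "D \<subseteq> verts G" using D(2) by (simp add: independent_set_def)
  ultimately have "card D \<le> wiener_index G"
    using assms(2) by (intro card_le_wiener_index)
  with domination_degree_le[OF D(3,1)] show ?thesis by simp
qed

end
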